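(* Let $\mathbf{X}=A\mathbf{Z}+\mathbf{E}$ be the linear factor model described in the context, with $A\in[0,\infty)^{d\times K}$ satisfying: (i) $\sum_{a=1}^K A_{ja}=1$ for every $j\in\{1,\dots,d\}$; (ii) for every $a\in\{1,\dots,K\}$ there is at least one index $j$ with $A_{ja}=1$ and $A_{jb}=0$ for all $b\ne a$. Then $A$ can be uniquely recovered from the extremal correlation matrix $\mathcal{X}=A\odot A^\top$, up to column permutations; that is, if $A'\in[0,\infty)^{d\times K'}$ also satisfies (i) and (ii) (with $K'$ in place of $K$) and $A'\odot A'^\top=A\odot A^\top$, then $K'=K$ and $A'=AP$ for some $K\times K$ permutation matrix $P$. Consequently, the associated soft clusters $G_a=\{j\in\{1,\dots,d\}:A_{ja}\ne0\}$, $1\le a\le K$, are identifiable from $\mathcal{X}$ up to label switching.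
   Context: Linear factor model: $\mathbf{X}=A\mathbf{Z}+\mathbf{E}$ is $\mathbb{R}^d$-valued, $A\in[0,\infty)^{d\times K}$ deterministic. $\mathbf{Z}=(Z^{(1)},\dots,Z^{(K)})$ is a nonnegative random vector, regularly varying with tail index $1$ and asymptotically independent components: for some scaling sequence $(c_n)$, $n\mathbb{P}\{c_n^{-1}\mathbf{Z}\in\cdot\}\to\Lambda_{\mathbf{Z}}$ vaguely on $[0,\infty)^K\setminus\{0\}$, where $\Lambda_{\mathbf{Z}}=\sum_{k=1}^K\delta_0\otimes\dots\otimes\Lambda_{Z^{(k)}}\otimes\dots\otimes\delta_0$ and $\Lambda_{Z^{(k)}}(dy)=y^{-2}dy$ on $(0,\infty)$. The noise $\mathbf{E}$ has a lighter tail: $\lim_{x\to\infty}\mathbb{P}\{\|\mathbf{E}\|>x\}/\mathbb{P}\{\|\mathbf{Z}\|>x\}=0$. The number $K$ of factors is not known a priori. The extremal correlation matrix $\mathcal{X}=[\chi(i,j)]$ has entries $\chi(i,j)=\lim_{x\to\infty}\mathbb{P}\{X^{(i)}>x,X^{(j)}>x\}/\mathbb{P}\{X^{(j)}>x\}$, and in this model, under (i), $\mathcal{X}=A\odot A^\top$. Operation $\odot$: for a $p\times K$ matrix $(a_{ik})$ and a $K\times q$ matrix $(b_{mj})$, the result is the $p\times q$ matrix with entries $\sum_{k=1}^K a_{ik}\wedge b_{kj}$, where $\wedge$ denotes the minimum. *)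

theory Defs
  imports "HOL-Probability.Probability"
begin

definition nonneg_orthant :: "(real ^ 'k) set" where
  "nonneg_orthant = {z. \<forall>k. 0 \<le> z $ k}"

(* The measure y^(-2) dy on (0, \<infinity>). *)
definition pareto_tail_measure :: "real measure" where
  "pareto_tail_measure = density lborel (\<lambda>y. indicator {0<..} y * ennreal (1 / y\<^sup>2))"

(* The product of pareto_tail_measure in the k-th coordinate with Dirac measures at 0 in all
   other coordinates is the image of pareto_tail_measure under y \<mapsto> axis k y; the limit measure
   of a vector with asymptotically independent components is the sum of these over k. *)
definition asymp_indep_measure :: "(real ^ 'k) measure" where
  "asymp_indep_measure = measure_of UNIV (sets borel)
     (\<lambda>B. \<Sum>k\<in>UNIV. emeasure (distr pareto_tail_measure borel (axis k)) B)"

lemma sets_asymp_indep_measure [simp, measurable_cong]: "sets asymp_indep_measure = sets borel"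
  unfolding asymp_indep_measure_def
  by (metis sets.sets_measure_of_eq space_borel)

lemma emeasure_asymp_indep_measure:
  assumes "B \<in> sets borel"
  shows "emeasure asymp_indep_measure B =
           (\<Sum>k\<in>UNIV. emeasure (distr pareto_tail_measure borel (axis k)) B)"
proof (rule emeasure_measure_of[OF asymp_indep_measure_def])
  show "sets borel \<subseteq> Pow UNIV" by simp
  show "B \<in> sets asymp_indep_measure" using assms by simp
  show "positive (sets asymp_indep_measure)
          (\<lambda>B. \<Sum>k\<in>UNIV. emeasure (distr pareto_tail_measure borel (axis k)) B)"
    by (simp add: positive_def)
  show "countably_additive (sets asymp_indep_measure)
          (\<lambda>B. \<Sum>k\<in>UNIV. emeasure (distr pareto_tail_measure borel (axis k)) B)"
    by (auto simp: countably_additive_def suminf_sum suminf_emeasure)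
qed

(* Vague convergence on the punctured orthant, where the bounded sets are those bounded away
   from the origin: the test functions may be non-zero arbitrarily far out, so no mass can
   escape to infinity. *)
definition vague_conv_punctured ::
    "(nat \<Rightarrow> (real ^ 'k) measure) \<Rightarrow> (real ^ 'k) measure \<Rightarrow> bool" where
  "vague_conv_punctured \<mu> \<Lambda> \<longleftrightarrow>
     (\<forall>f :: real ^ 'k \<Rightarrow> real.
        continuous_on (nonneg_orthant - {0}) f \<and>
        (\<forall>z \<in> nonneg_orthant - {0}. 0 \<le> f z) \<and>
        bounded (f ` (nonneg_orthant - {0})) \<and>
        (\<exists>r > 0. \<forall>z \<in> nonneg_orthant - {0}. norm z < r \<longrightarrow> f z = 0)
        \<longrightarrow> (\<lambda>n. \<integral>\<^sup>+ z \<in> nonneg_orthant - {0}. ennreal (f z) \<partial>\<mu> n)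
              \<longlonglongrightarrow> (\<integral>\<^sup>+ z \<in> nonneg_orthant - {0}. ennreal (f z) \<partial>\<Lambda>))"

(* No independence between Z and E is assumed. *)
locale linear_factor_model = prob_space M
  for M :: "'w measure" +
  fixes A :: "real ^ 'k ^ 'd"
    and Z :: "'w \<Rightarrow> real ^ 'k"
    and E :: "'w \<Rightarrow> real ^ 'd"
    and X :: "'w \<Rightarrow> real ^ 'd"
  assumes loadings_nonneg: "\<And>j k. 0 \<le> A $ j $ k"
    and Z_random [measurable]: "random_variable borel Z"
    and E_random [measurable]: "random_variable borel E"
    and model_eq: "\<And>\<omega>. \<omega> \<in> space M \<Longrightarrow> X \<omega> = A *v Z \<omega> + E \<omega>"
    and Z_nonneg: "\<And>\<omega>. \<omega> \<in> space M \<Longrightarrow> Z \<omega> \<in> nonneg_orthant"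
    and Z_regularly_varying:
      "\<exists>c :: nat \<Rightarrow> real. (\<forall>n. 0 < c n) \<and> filterlim c at_top sequentially \<and>
         vague_conv_punctured
           (\<lambda>n. scale_measure (of_nat n) (distr M borel (\<lambda>\<omega>. inverse (c n) *\<^sub>R Z \<omega>)))
           asymp_indep_measure"
    and E_lighter_tail:
      "((\<lambda>x. prob {\<omega> \<in> space M. norm (E \<omega>) > x} / prob {\<omega> \<in> space M. norm (Z \<omega>) > x})
          \<longlongrightarrow> 0) at_top"

definition extremal_correlation_matrix ::
    "'w measure \<Rightarrow> ('w \<Rightarrow> real ^ 'd) \<Rightarrow> real ^ 'd ^ 'd \<Rightarrow> bool" where
  "extremal_correlation_matrix M X C \<longleftrightarrow>
     (\<forall>i j. ((\<lambda>x. measure M {\<omega> \<in> space M. X \<omega> $ i > x \<and> X \<omega> $ j > x}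
                  / measure M {\<omega> \<in> space M. X \<omega> $ j > x}) \<longlongrightarrow> C $ i $ j) at_top)"

definition min_prod :: "real ^ 'k ^ 'p \<Rightarrow> real ^ 'q ^ 'k \<Rightarrow> real ^ 'q ^ 'p"
    (infixl "\<odot>" 70) where
  "A \<odot> B = (\<chi> i j. \<Sum>k\<in>UNIV. min (A $ i $ k) (B $ k $ j))"

definition unit_row_sums :: "real ^ 'k ^ 'd \<Rightarrow> bool" where
  "unit_row_sums A \<longleftrightarrow> (\<forall>j. (\<Sum>a\<in>UNIV. A $ j $ a) = 1)"

definition has_pure_variables :: "real ^ 'k ^ 'd \<Rightarrow> bool" where
  "has_pure_variables A \<longleftrightarrow> (\<forall>a. \<exists>j. A $ j $ a = 1 \<and> (\<forall>b. b \<noteq> a \<longrightarrow> A $ j $ b = 0))"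

definition soft_cluster :: "real ^ 'k ^ 'd \<Rightarrow> 'k \<Rightarrow> 'd set" where
  "soft_cluster A a = {j. A $ j $ a \<noteq> 0}"

(* Rows and columns may carry different index types; a bijection between them
   exists only if the matrix is square. *)
definition permutation_matrix :: "('l \<Rightarrow> 'k) \<Rightarrow> real ^ 'l ^ 'k" where
  "permutation_matrix \<sigma> = (\<chi> k l. if k = \<sigma> l then 1 else 0)"

end

theory Submission
  imports Defs
begin

text \<open>
  Identifiability: if row \<open>i\<close> of \<open>A\<close> is the unit vector \<open>e\<^sub>a\<close>, then row \<open>i\<close> of \<open>A \<odot> A\<^sup>T\<close> is
  column \<open>a\<close> of \<open>A\<close>. Choose such a row \<open>p a\<close> for each \<open>a\<close>. For a competitor \<open>B\<close>, the probability
  vectors \<open>B\<^bsub>p a\<^esub>\<close> have pairwise disjoint supports, and comparison with the pure rows of \<open>B\<close>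
  shows that they add up to the all-ones vector; hence they are exactly the unit vectors, and
  \<open>A\<close> and \<open>B\<close> have the same columns.

  Extremal correlation: for continuous, positively homogeneous \<open>h\<close>, testing vague convergence
  with ramp functions of \<open>h\<close> gives \<open>n P(h(Z) > c\<^sub>n t) \<rightarrow> t\<^sup>-\<^sup>1 \<Sum>\<^sub>k h(e\<^sub>k)\<close>.
  Choosing \<open>N(x)\<close> of order \<open>1 / P(\<parallel>Z\<parallel> > x)\<close> turns this into a limit in \<open>x\<close>; it is applied to
  \<open>h(z) = min ((Az)\<^sub>i, (Az)\<^sub>j)\<close>, and the noise only perturbs the thresholds by a factor \<open>1 \<plusminus> \<delta>\<close>.
\<close>

section \<open>Identifiability of the loading matrix\<close>

lemma min_prod_transpose_nth:
  "(A \<odot> transpose A) $ i $ j = (\<Sum>k\<in>UNIV. min (A $ i $ k) (A $ j $ k))"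
  by (simp add: min_prod_def transpose_def)

lemma entry_le_1:
  assumes "\<And>j a. 0 \<le> A $ j $ a" and "unit_row_sums A"
  shows "A $ j $ a \<le> 1"
proof -
  have "A $ j $ a \<le> (\<Sum>a\<in>UNIV. A $ j $ a)"
    by (rule member_le_sum) (auto simp: assms(1))
  then show ?thesis using assms(2) by (simp add: unit_row_sums_def)
qed

text \<open>All entries lie in [0, 1], so the minimum with an entry 1 returns the other entry and
  the minimum with 0 is 0.\<close>

lemma min_prod_transpose_pure:
  assumes nonneg: "\<And>j a. 0 \<le> A $ j $ a" and rows: "unit_row_sums A"
    and pure: "\<And>b. A $ i $ b = (if b = a then 1 else 0)"
  shows "(A \<odot> transpose A) $ i $ j = A $ j $ a"
proof -
  have "min (A $ i $ k) (A $ j $ k) = (if k = a then A $ j $ a else 0)" for k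
    using nonneg[of j k] entry_le_1[OF nonneg rows, of j k] by (auto simp: pure)
  then show ?thesis by (simp add: min_prod_transpose_nth)
qed

lemma has_pure_variablesE:
  assumes "has_pure_variables A"
  obtains p where "\<And>a b. A $ p a $ b = (if b = a then 1 else 0)"
proof -
  have "\<forall>a. \<exists>j. \<forall>b. A $ j $ b = (if b = a then 1 else 0)"
    using assms unfolding has_pure_variables_def by metis
  then show ?thesis using that by metis
qed

lemma matrix_mult_permutation_matrix_nth:
  "(A ** permutation_matrix \<sigma>) $ j $ l = A $ j $ \<sigma> l"
  by (simp add: matrix_matrix_mult_def permutation_matrix_def if_distrib[of "(*) _"] cong: if_cong)

text \<open>The array \<open>B $ p a $ b\<close> is nonnegative with row and column sums 1, and its
  rows have disjoint supports, so it is a 0-1 permutation array. The index types \<open>'k\<close>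
  and \<open>'l\<close> are unrelated; the bijection itself shows that the numbers of factors
  agree.\<close>

theorem loadings_identifiable:
  fixes A :: "real ^ 'k ^ 'd" and B :: "real ^ 'l ^ 'd"
  assumes A: "\<And>j a. 0 \<le> A $ j $ a" "unit_row_sums A" "has_pure_variables A"
    and B: "\<And>j a. 0 \<le> B $ j $ a" "unit_row_sums B" "has_pure_variables B"
    and eq: "B \<odot> transpose B = A \<odot> transpose A"
  obtains \<sigma> :: "'l \<Rightarrow> 'k" where "bij \<sigma>" "\<And>j b. B $ j $ b = A $ j $ \<sigma> b"
proof -
  obtain p where p: "\<And>a b. A $ p a $ b = (if b = a then 1 else 0)"
    using A(3) by (rule has_pure_variablesE) blast
  obtain q where q: "\<And>a b. B $ q a $ b = (if b = a then 1 else 0)"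
    using B(3) by (rule has_pure_variablesE) blast
  have col: "(B \<odot> transpose B) $ p a $ j = A $ j $ a" for a j
    unfolding eq by (rule min_prod_transpose_pure[OF A(1,2) p])
  have col': "(B \<odot> transpose B) $ q b $ j = B $ j $ b" for b j
    by (rule min_prod_transpose_pure[OF B(1,2) q])
  \<comment> \<open>Entry (\<open>p a\<close>, \<open>p a'\<close>) of the common product is
    \<open>A $ p a' $ a = 0\<close>, and a vanishing sum of nonnegative minima has only zero
    terms.\<close>
  have disjoint: "B $ p a $ b = 0 \<or> B $ p a' $ b = 0" if "a \<noteq> a'" for a a' b
  proof -
    have "(\<Sum>b\<in>UNIV. min (B $ p a $ b) (B $ p a' $ b)) = 0"
      using col[of a "p a'"] that by (simp add: p min_prod_transpose_nth)
    then have "min (B $ p a $ b) (B $ p a' $ b) = 0"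
      by (subst (asm) sum_nonneg_eq_0_iff) (auto simp: B(1))
    then show ?thesis by (auto simp: min_def split: if_splits)
  qed
  \<comment> \<open>Entry (\<open>p a\<close>, \<open>q b\<close>) of the common product is read off
    through the pure row of \<open>A\<close> and, by symmetry, through that of \<open>B\<close>.
    Column sums of the array thus become row sums of \<open>A\<close>.\<close>
  have "B $ p a $ b = A $ q b $ a" for a b
    using col[of a "q b"] col'[of b "p a"]
    by (simp add: min_prod_transpose_nth min.commute)
  then have colsum: "(\<Sum>a\<in>UNIV. B $ p a $ b) = 1" for b
    using A(2) by (simp add: unit_row_sums_def)
  have rowsum: "(\<Sum>b\<in>UNIV. B $ p a $ b) = 1" for a
    using B(2) by (simp add: unit_row_sums_def)
  have "\<exists>a. B $ p a $ b \<noteq> 0" for b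
  proof (rule ccontr)
    assume "\<not> ?thesis"
    then show False using colsum[of b] by simp
  qed
  then obtain \<sigma> where \<sigma>: "\<And>b. B $ p (\<sigma> b) $ b \<noteq> 0" by metis
  have one: "B $ p (\<sigma> b) $ b = 1" for b
  proof -
    have "B $ p a $ b = (if a = \<sigma> b then B $ p (\<sigma> b) $ b else 0)" for a
      using disjoint[of a "\<sigma> b" b] \<sigma>[of b] by auto
    then have "(\<Sum>a\<in>UNIV. B $ p a $ b) = (\<Sum>a\<in>UNIV. if a = \<sigma> b then B $ p (\<sigma> b) $ b else 0)"
      by (intro sum.cong) auto
    then show ?thesis using colsum[of b] by simp
  qed
  have unit: "B $ p (\<sigma> b) $ b' = (if b' = b then 1 else 0)" for b b'
  proof (cases "b' = b")
    case False
    have "(\<Sum>b'\<in>UNIV - {b}. B $ p (\<sigma> b) $ b') = 0"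
      using rowsum[of "\<sigma> b"] one[of b] by (simp add: sum.remove[of UNIV b])
    then have "\<forall>b'\<in>UNIV - {b}. B $ p (\<sigma> b) $ b' = 0"
      by (subst (asm) sum_nonneg_eq_0_iff) (auto simp: B(1))
    then show ?thesis using False by simp
  qed (simp add: one)
  have "inj \<sigma>"
    by (rule injI) (metis unit zero_neq_one)
  moreover have "\<exists>b. a = \<sigma> b" for a
  proof -
    have "\<exists>b. B $ p a $ b \<noteq> 0"
    proof (rule ccontr)
      assume "\<not> ?thesis"
      then show False using rowsum[of a] by simp
    qed
    then show ?thesis using disjoint \<sigma> by metis
  qed
  ultimately have "bij \<sigma>" by (auto simp: bij_def surj_def)
  \<comment> \<open>Index \<open>p (\<sigma> b)\<close> is pure for \<open>\<sigma> b\<close> in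
    \<open>A\<close> and for \<open>b\<close> in \<open>B\<close>, so one row of the common product
    is both columns.\<close>
  moreover have "B $ j $ b = A $ j $ \<sigma> b" for j b
    using min_prod_transpose_pure[OF B(1,2) unit, of b j] col[of "\<sigma> b" j] by simp
  ultimately show ?thesis by (rule that)
qed

section \<open>Tails of the factors\<close>

lemma emeasure_pareto_tail_measure:
  assumes "0 < t"
  shows "emeasure pareto_tail_measure {t..} = ennreal (1 / t)"
proof -
  have "emeasure pareto_tail_measure {t..} =
      (\<integral>\<^sup>+y. (indicator {0<..} y * ennreal (1 / y\<^sup>2)) * indicator {t..} y \<partial>lborel)"
    unfolding pareto_tail_measure_def by (rule emeasure_density) auto
  also have "\<dots> = (\<integral>\<^sup>+y. ennreal (1 / y\<^sup>2) * indicator {t..} y \<partial>lborel)"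
    using assms by (intro nn_integral_cong) (auto split: split_indicator)
  also have "\<dots> = ennreal (0 - (- (1 / t)))"
  proof (rule nn_integral_FTC_atLeast)
    show "((\<lambda>y. - (1 / y)) has_real_derivative 1 / y\<^sup>2) (at y)" if "t \<le> y" for y :: real
      using that assms by (auto intro!: derivative_eq_intros simp: power2_eq_square field_simps)
    show "((\<lambda>y. - (1 / y)) \<longlongrightarrow> (0::real)) at_top"
      by real_asymp
  qed auto
  finally show ?thesis by simp
qed

text \<open>Homogeneity includes \<open>r = 0\<close> and so forces \<open>h 0 = 0\<close>.
  Nonnegativity is asked only on the orthant, which admits linear forms with nonnegative
  coefficients and their minima.\<close>

definition tail_functional :: "(real ^ 'k \<Rightarrow> real) \<Rightarrow> bool" where
  "tail_functional h \<longleftrightarrow> continuous_on UNIV h \<and>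
     (\<forall>r z. 0 \<le> r \<longrightarrow> h (r *\<^sub>R z) = r * h z) \<and> (\<forall>z\<in>nonneg_orthant. 0 \<le> h z)"

text \<open>The limit measure lives on the coordinate axes, so a homogeneous \<open>h\<close> enters
  its tail only through the values at the unit vectors.\<close>

definition axis_total :: "(real ^ 'k \<Rightarrow> real) \<Rightarrow> real" where
  "axis_total h = (\<Sum>k\<in>UNIV. h (axis k 1))"

lemma axis_in_nonneg_orthant: "axis k y \<in> nonneg_orthant \<longleftrightarrow> 0 \<le> y"
  by (auto simp: nonneg_orthant_def axis_def)

lemma axis_total_nonneg: "tail_functional h \<Longrightarrow> 0 \<le> axis_total h"
  by (auto simp: axis_total_def tail_functional_def axis_in_nonneg_orthant intro!: sum_nonneg)

lemma closed_nonneg_orthant: "closed nonneg_orthant"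
  unfolding nonneg_orthant_def
  by (intro closed_Collect_all closed_Collect_le continuous_intros)

lemma borel_measurable_axis [measurable]:
  "axis k \<in> borel_measurable (borel :: real measure)"
proof -
  have "axis k = (\<lambda>y. y *\<^sub>R axis k (1::real))"
    by (simp add: axis_def vec_eq_iff fun_eq_iff)
  moreover have "(\<lambda>y. y *\<^sub>R axis k (1::real)) \<in> borel_measurable borel"
    by measurable
  ultimately show ?thesis by simp
qed

text \<open>On the \<open>k\<close>-th half-axis \<open>h\<close> is linear with slope
  \<open>h (axis k 1)\<close>. The set meets it in a closed half-line whose Pareto mass is this
  slope over \<open>t\<close>, or not at all if the slope is 0.\<close>

lemma emeasure_asymp_indep_measure_tail:
  assumes h: "tail_functional h" and "0 < t"
  shows "emeasure asymp_indep_measure {z \<in> nonneg_orthant - {0}. t \<le> h z} =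
    ennreal (axis_total h / t)"
proof -
  let ?B = "{z \<in> nonneg_orthant - {0}. t \<le> h z}"
  have hm [measurable]: "h \<in> borel_measurable borel"
    using h by (auto simp: tail_functional_def intro: borel_measurable_continuous_onI)
  have [measurable]: "nonneg_orthant \<in> sets borel"
    using closed_nonneg_orthant by (rule borel_closed)
  have B: "?B \<in> sets borel" by measurable
  have scale: "axis k y = y *\<^sub>R axis k (1::real)" for k :: 'a and y
    by (simp add: axis_def vec_eq_iff)
  have "emeasure (distr pareto_tail_measure borel (axis k)) ?B = ennreal (h (axis k 1) / t)" for k
  proof -
    let ?m = "h (axis k 1)"
    have m: "0 \<le> ?m" using h by (auto simp: tail_functional_def axis_in_nonneg_orthant)
    have hk: "h (axis k y) = y * ?m" if "0 \<le> y" for y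
      using h that by (subst scale) (auto simp: tail_functional_def)
    have pre: "axis k -` ?B = (if ?m = 0 then {} else {t / ?m..})"
    proof -
      have "y \<in> axis k -` ?B \<longleftrightarrow> 0 < y \<and> t \<le> y * ?m" for y
        using hk[of y] by (auto simp: axis_in_nonneg_orthant axis_eq_0_iff less_le)
      moreover have "(0 < y \<and> t \<le> y * ?m) \<longleftrightarrow> ?m \<noteq> 0 \<and> t / ?m \<le> y" for y
      proof (cases "?m = 0")
        case False
        then have "0 < ?m" using m by simp
        moreover have "0 < y" if "t / ?m \<le> y"
          using that \<open>0 < ?m\<close> \<open>0 < t\<close> by (meson divide_pos_pos less_le_trans)
        ultimately show ?thesis by (auto simp: field_simps)
      qed (use \<open>0 < t\<close> in auto)
      ultimately show ?thesis by auto
    qed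
    have "emeasure (distr pareto_tail_measure borel (axis k)) ?B =
        emeasure pareto_tail_measure (axis k -` ?B \<inter> space pareto_tail_measure)"
      using B by (intro emeasure_distr) (simp_all add: pareto_tail_measure_def)
    also have "\<dots> = emeasure pareto_tail_measure (if ?m = 0 then {} else {t / ?m..})"
      by (simp add: pre[symmetric] pareto_tail_measure_def)
    also have "\<dots> = ennreal (?m / t)"
      using m \<open>0 < t\<close> by (auto simp: emeasure_pareto_tail_measure)
    finally show ?thesis .
  qed
  then have "emeasure asymp_indep_measure ?B = (\<Sum>k\<in>UNIV. ennreal (h (axis k 1) / t))"
    by (simp only: emeasure_asymp_indep_measure[OF B])
  also have "\<dots> = ennreal (\<Sum>k\<in>UNIV. h (axis k 1) / t)"
    using h \<open>0 < t\<close>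
    by (intro sum_ennreal) (auto simp: tail_functional_def axis_in_nonneg_orthant)
  finally show ?thesis by (simp add: axis_total_def sum_divide_distrib)
qed

lemma tail_functional_norm: "tail_functional norm"
  by (auto simp: tail_functional_def intro!: continuous_intros)

lemma axis_total_norm: "axis_total (norm :: real ^ 'k \<Rightarrow> real) = CARD('k)"
  by (simp add: axis_total_def)

text \<open>Squeeze for quantities controlled only at thresholds \<open>s\<close> near
  \<open>t\<close>: continuity of \<open>H / s\<close> at \<open>t\<close> closes the gap. It serves
  to remove the ramps, to pass from the sequence to a continuous variable, and to absorb the
  noise.\<close>

lemma tendsto_divide_if_bracketed:
  fixes f :: "'a \<Rightarrow> real"
  assumes "0 < t" and "0 \<le> H"
    and upper: "\<And>s u. 0 < s \<Longrightarrow> s < t \<Longrightarrow> H / s < u \<Longrightarrow> eventually (\<lambda>x. f x < u) F"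
    and lower: "\<And>s u. t < s \<Longrightarrow> u < H / s \<Longrightarrow> eventually (\<lambda>x. u < f x) F"
  shows "(f \<longlongrightarrow> H / t) F"
proof -
  have lim: "((\<lambda>s. H / s) \<longlongrightarrow> H / t) (at t)"
    using \<open>0 < t\<close> by (intro tendsto_intros) auto
  show ?thesis
  proof (rule order_tendstoI)
    fix u assume "H / t < u"
    then have "eventually (\<lambda>s. H / s < u) (at_left t)"
      using lim by (auto intro: order_tendstoD filterlim_mono at_le)
    moreover have "eventually (\<lambda>s. s \<in> {0<..<t}) (at_left t)"
      using \<open>0 < t\<close> by (intro eventually_at_leftI[of 0]) auto
    ultimately have "eventually (\<lambda>s. H / s < u \<and> s \<in> {0<..<t}) (at_left t)"
      by eventually_elim auto
    then obtain s where "H / s < u" "0 < s" "s < t"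
      using eventually_happens'[OF trivial_limit_at_left_real] by fastforce
    then show "eventually (\<lambda>x. f x < u) F" by (intro upper)
  next
    fix u assume "u < H / t"
    then have "eventually (\<lambda>s. u < H / s) (at_right t)"
      using lim by (auto intro: order_tendstoD filterlim_mono at_le)
    moreover have "eventually (\<lambda>s. s \<in> {t<..<t + 1}) (at_right t)"
      by (rule eventually_at_rightI[of _ "t + 1"]) auto
    ultimately have "eventually (\<lambda>s. u < H / s \<and> s \<in> {t<..<t + 1}) (at_right t)"
      by eventually_elim auto
    then obtain s where "u < H / s" "t < s"
      using eventually_happens'[OF trivial_limit_at_right_real] by fastforce
    then show "eventually (\<lambda>x. u < f x) F" by (intro lower)
  qed
qed

section \<open>From vague convergence to tail limits in a continuous variable\<close>

context linear_factor_model
begin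

text \<open>Indicators of exceedance sets are not continuous, so they are replaced by a ramp rising
  from 0 at level \<open>a\<close> to 1 at level \<open>b\<close>, which lies between two of them.
  \<open>I\<close> and \<open>L\<close> are the integrals of the ramp.\<close>

lemma ramp_integral_bounds:
  fixes c :: "nat \<Rightarrow> real"
  assumes h: "tail_functional h" and c: "\<And>n. 0 < c n"
    and conv: "vague_conv_punctured
           (\<lambda>n. scale_measure (of_nat n) (distr M borel (\<lambda>\<omega>. inverse (c n) *\<^sub>R Z \<omega>)))
           asymp_indep_measure"
    and "0 < a" "a < b"
  shows "\<exists>I L. I \<longlonglongrightarrow> L \<and>
    (\<forall>n. ennreal (n * prob {\<omega> \<in> space M. c n * b < h (Z \<omega>)}) \<le> I n) \<and>
    (\<forall>n. I n \<le> ennreal (n * prob {\<omega> \<in> space M. c n * a < h (Z \<omega>)})) \<and>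
    ennreal (axis_total h / b) \<le> L \<and> L \<le> ennreal (axis_total h / a)"
proof -
  let ?\<mu> = "\<lambda>n::nat. scale_measure (of_nat n) (distr M borel (\<lambda>\<omega>. inverse (c n) *\<^sub>R Z \<omega>))"
  let ?S = "nonneg_orthant - {0}"
  define f where "f z = max 0 (min 1 ((h z - a) / (b - a)))" for z
  have hm [measurable]: "h \<in> borel_measurable borel"
    using h by (auto simp: tail_functional_def intro: borel_measurable_continuous_onI)
  have [measurable]: "nonneg_orthant \<in> sets borel"
    using closed_nonneg_orthant by (rule borel_closed)
  have cont: "continuous_on X h" for X
    using h by (auto simp: tail_functional_def intro: continuous_on_subset)
  have h0: "h 0 = 0"
  proof -
    have "h (0 *\<^sub>R 0) = 0 * h 0" using h unfolding tail_functional_def by blast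
    then show ?thesis by simp
  qed
  have f_lower: "1 \<le> f z" if "b \<le> h z" for z
    using that \<open>a < b\<close> by (auto simp: f_def field_simps max_def)
  have f_upper: "f z \<le> (if a < h z then 1 else 0)" for z
    using \<open>a < b\<close> by (auto simp: f_def field_simps divide_nonpos_pos)
  have f_nonneg: "0 \<le> f z" and f_le_1: "f z \<le> 1" for z
    by (auto simp: f_def)
  \<comment> \<open>Since \<open>h 0 = 0 < a\<close>, the ramp vanishes near the origin, as a test
    function must.\<close>
  obtain r where r: "0 < r" "\<And>z. norm z < r \<Longrightarrow> h z < a"
  proof -
    have "open {z. h z < a}" by (intro open_Collect_less cont continuous_intros)
    moreover have "0 \<in> {z. h z < a}" using h0 \<open>0 < a\<close> by simp
    ultimately obtain r where "0 < r" "ball 0 r \<subseteq> {z. h z < a}"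
      by (rule openE)
    then show ?thesis by (intro that[of r]) auto
  qed
  have lim: "(\<lambda>n. \<integral>\<^sup>+ z \<in> ?S. ennreal (f z) \<partial>?\<mu> n) \<longlonglongrightarrow>
      (\<integral>\<^sup>+ z \<in> ?S. ennreal (f z) \<partial>asymp_indep_measure)"
  proof (rule conv[unfolded vague_conv_punctured_def, rule_format], intro conjI ballI)
    show "continuous_on ?S f" unfolding f_def using \<open>a < b\<close>
      by (intro continuous_intros cont) auto
    show "0 \<le> f z" for z by (rule f_nonneg)
    show "bounded (f ` ?S)"
      using f_nonneg f_le_1 by (intro boundedI[of _ 1]) auto
    have "f z = 0" if "norm z < r" for z
      using f_upper[of z] f_nonneg[of z] r(2)[OF that] by (auto split: if_splits)
    then show "\<exists>r>0. \<forall>z\<in>?S. norm z < r \<longrightarrow> f z = 0" using r(1) by blast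
  qed
  have prob_eq: "(\<integral>\<^sup>+ z \<in> ?S. indicator {z. s < h z} z \<partial>?\<mu> n) =
      ennreal (n * prob {\<omega> \<in> space M. c n * s < h (Z \<omega>)})" if "0 < s" for s n
  proof -
    have "(\<integral>\<^sup>+ z \<in> ?S. indicator {z. s < h z} z \<partial>?\<mu> n) =
        (\<integral>\<^sup>+ z. indicator {z \<in> ?S. s < h z} z \<partial>?\<mu> n)"
      by (intro nn_integral_cong) (auto split: split_indicator)
    also have "\<dots> = emeasure (?\<mu> n) {z \<in> ?S. s < h z}"
      by (rule nn_integral_indicator) measurable
    also have "\<dots> = of_nat n * emeasure M
        ((\<lambda>\<omega>. inverse (c n) *\<^sub>R Z \<omega>) -` {z \<in> ?S. s < h z} \<inter> space M)"
    proof -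
      have "{z \<in> ?S. s < h z} \<in> sets borel" by measurable
      moreover have "(\<lambda>\<omega>. inverse (c n) *\<^sub>R Z \<omega>) \<in> borel_measurable M" by measurable
      ultimately show ?thesis by (simp only: emeasure_scale_measure emeasure_distr)
    qed
    also have "(\<lambda>\<omega>. inverse (c n) *\<^sub>R Z \<omega>) -` {z \<in> ?S. s < h z} \<inter> space M =
        {\<omega> \<in> space M. c n * s < h (Z \<omega>)}"
    proof -
      \<comment> \<open>Homogeneity moves the scaling into the threshold; a vector with
        \<open>h\<close> above \<open>s > 0\<close> is automatically nonzero.\<close>
      have "inverse (c n) *\<^sub>R Z \<omega> \<in> {z \<in> ?S. s < h z} \<longleftrightarrow> c n * s < h (Z \<omega>)"
        if "\<omega> \<in> space M" for \<omega>
      proof -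
        have "h (inverse (c n) *\<^sub>R Z \<omega>) = inverse (c n) * h (Z \<omega>)"
          using h c[of n] by (simp add: tail_functional_def)
        moreover have "s < inverse (c n) * y \<longleftrightarrow> c n * s < y" for y
          using c[of n] by (simp add: field_simps)
        ultimately have "s < h (inverse (c n) *\<^sub>R Z \<omega>) \<longleftrightarrow> c n * s < h (Z \<omega>)"
          by (simp only:)
        moreover have "inverse (c n) *\<^sub>R Z \<omega> \<in> nonneg_orthant"
          using Z_nonneg[OF that] c[of n] by (simp add: nonneg_orthant_def)
        moreover have "inverse (c n) *\<^sub>R Z \<omega> \<noteq> 0" if "s < h (inverse (c n) *\<^sub>R Z \<omega>)"
          using that h0 \<open>0 < s\<close> by (metis less_asym)
        ultimately show ?thesis by blast
      qed
      then show ?thesis by blast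
    qed
    finally show ?thesis
      by (simp add: emeasure_eq_measure ennreal_mult ennreal_of_nat_eq_real_of_nat)
  qed
  have lim_eq: "(\<integral>\<^sup>+ z \<in> ?S. indicator {z. s \<le> h z} z \<partial>asymp_indep_measure) =
      ennreal (axis_total h / s)" if "0 < s" for s
  proof -
    have "(\<integral>\<^sup>+ z \<in> ?S. indicator {z. s \<le> h z} z \<partial>asymp_indep_measure) =
        (\<integral>\<^sup>+ z. indicator {z \<in> ?S. s \<le> h z} z \<partial>asymp_indep_measure)"
      by (intro nn_integral_cong) (auto split: split_indicator)
    also have "\<dots> = emeasure asymp_indep_measure {z \<in> ?S. s \<le> h z}"
      by (rule nn_integral_indicator) measurable
    finally show ?thesis using emeasure_asymp_indep_measure_tail[OF h that] by simp
  qed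
  have "0 < b" using \<open>0 < a\<close> \<open>a < b\<close> by simp
  show ?thesis
  proof (intro exI conjI allI)
    show "ennreal (n * prob {\<omega> \<in> space M. c n * b < h (Z \<omega>)}) \<le>
        (\<integral>\<^sup>+ z \<in> ?S. ennreal (f z) \<partial>?\<mu> n)" for n
      unfolding prob_eq[OF \<open>0 < b\<close>, symmetric] using f_lower
      by (intro nn_integral_mono) (auto split: split_indicator)
    show "(\<integral>\<^sup>+ z \<in> ?S. ennreal (f z) \<partial>?\<mu> n) \<le>
        ennreal (n * prob {\<omega> \<in> space M. c n * a < h (Z \<omega>)})" for n
    proof -
      have "ennreal (f z) \<le> indicator {z. a < h z} z" for z
        using f_upper[of z] by (auto split: split_indicator if_splits simp: ennreal_eq_0_iff)
      then show ?thesis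
        unfolding prob_eq[OF \<open>0 < a\<close>, symmetric]
        by (intro nn_integral_mono mult_right_mono) auto
    qed
    show "ennreal (axis_total h / b) \<le> (\<integral>\<^sup>+ z \<in> ?S. ennreal (f z) \<partial>asymp_indep_measure)"
      unfolding lim_eq[OF \<open>0 < b\<close>, symmetric] using f_lower
      by (intro nn_integral_mono) (auto split: split_indicator)
    have "ennreal (f z) \<le> indicator {z. a \<le> h z} z" for z
      using f_upper[of z] by (auto split: split_indicator if_splits simp: ennreal_eq_0_iff)
    then show "(\<integral>\<^sup>+ z \<in> ?S. ennreal (f z) \<partial>asymp_indep_measure) \<le> ennreal (axis_total h / a)"
      unfolding lim_eq[OF \<open>0 < a\<close>, symmetric]
      by (intro nn_integral_mono mult_right_mono) auto
  qed (rule lim)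
qed

text \<open>A ramp ending at level \<open>t\<close> bounds the exceedance of \<open>t\<close> from
  above, one starting at \<open>t\<close> bounds it from below.\<close>

lemma tail_functional_sequence_limit:
  fixes c :: "nat \<Rightarrow> real"
  assumes h: "tail_functional h" and c: "\<And>n. 0 < c n"
    and conv: "vague_conv_punctured
           (\<lambda>n. scale_measure (of_nat n) (distr M borel (\<lambda>\<omega>. inverse (c n) *\<^sub>R Z \<omega>)))
           asymp_indep_measure"
    and "0 < t"
  shows "(\<lambda>n. n * prob {\<omega> \<in> space M. c n * t < h (Z \<omega>)}) \<longlonglongrightarrow> axis_total h / t"
proof (rule tendsto_divide_if_bracketed[OF \<open>0 < t\<close> axis_total_nonneg[OF h]])
  fix s u assume "0 < s" "s < t" and u: "axis_total h / s < u"
  obtain I L where IL: "I \<longlonglongrightarrow> L"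
    "\<And>n. ennreal (n * prob {\<omega> \<in> space M. c n * t < h (Z \<omega>)}) \<le> I n"
    "\<And>n. I n \<le> ennreal (n * prob {\<omega> \<in> space M. c n * s < h (Z \<omega>)})"
    "ennreal (axis_total h / t) \<le> L" "L \<le> ennreal (axis_total h / s)"
    using ramp_integral_bounds[OF h c conv \<open>0 < s\<close> \<open>s < t\<close>] by blast
  have "0 \<le> axis_total h / s" using axis_total_nonneg[OF h] \<open>0 < s\<close> by simp
  then have "ennreal (axis_total h / s) < ennreal u" using u by (simp add: ennreal_less_iff)
  with IL(5) have "L < ennreal u" by (rule le_less_trans)
  with IL(1) have "eventually (\<lambda>n. I n < ennreal u) sequentially" by (rule order_tendstoD)
  then show "eventually (\<lambda>n. n * prob {\<omega> \<in> space M. c n * t < h (Z \<omega>)} < u) sequentially"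
  proof eventually_elim
    case (elim n)
    show ?case
      using le_less_trans[OF IL(2) elim] by (subst (asm) ennreal_less_iff) simp_all
  qed
next
  fix s u assume "t < s" and u: "u < axis_total h / s"
  obtain I L where IL: "I \<longlonglongrightarrow> L"
    "\<And>n. ennreal (n * prob {\<omega> \<in> space M. c n * s < h (Z \<omega>)}) \<le> I n"
    "\<And>n. I n \<le> ennreal (n * prob {\<omega> \<in> space M. c n * t < h (Z \<omega>)})"
    "ennreal (axis_total h / s) \<le> L" "L \<le> ennreal (axis_total h / t)"
    using ramp_integral_bounds[OF h c conv \<open>0 < t\<close> \<open>t < s\<close>] by blast
  show "eventually (\<lambda>n. u < n * prob {\<omega> \<in> space M. c n * t < h (Z \<omega>)}) sequentially"
  \<comment> \<open>\<open>ennreal\<close> truncates negative reals to 0, so a negative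
    \<open>u\<close> is treated separately.\<close>
  proof (cases "u < 0")
    case True
    then show ?thesis by (intro always_eventually allI less_le_trans[OF True] mult_nonneg_nonneg) auto
  next
    case False
    then have "ennreal u < ennreal (axis_total h / s)" using u
      by (subst ennreal_less_iff) simp_all
    then have "ennreal u < L" using IL(4) by (rule less_le_trans)
    with IL(1) have "eventually (\<lambda>n. ennreal u < I n) sequentially" by (rule order_tendstoD)
    then show ?thesis
    proof eventually_elim
      case (elim n)
      show ?case
        using less_le_trans[OF elim IL(3)] False by (subst (asm) ennreal_less_iff) simp_all
    qed
  qed
qed

text \<open>A single \<open>N\<close> has to serve all \<open>h\<close> and \<open>t\<close>,
  because it is to cancel in quotients of tail probabilities. It is calibrated by the tail of the
  norm alone.\<close>

lemma tail_functional_limit: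
  obtains N :: "real \<Rightarrow> nat" where
    "\<And>h t. tail_functional h \<Longrightarrow> 0 < t \<Longrightarrow>
       ((\<lambda>x. N x * prob {\<omega> \<in> space M. t * x < h (Z \<omega>)}) \<longlongrightarrow> axis_total h / t) at_top"
proof -
  obtain c :: "nat \<Rightarrow> real" where c: "\<And>n. 0 < c n" "filterlim c at_top sequentially"
    and conv: "vague_conv_punctured
           (\<lambda>n. scale_measure (of_nat n) (distr M borel (\<lambda>\<omega>. inverse (c n) *\<^sub>R Z \<omega>)))
           asymp_indep_measure"
    using Z_regularly_varying by blast
  note seq = tail_functional_sequence_limit[OF _ c(1) conv]
  define G where "G x = prob {\<omega> \<in> space M. x < norm (Z \<omega>)}" for x
  define K where "K = real CARD('k)"
  have "1 \<le> K" by (simp add: K_def Suc_le_eq)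
  have G_anti: "G y \<le> G x" if "x \<le> y" for x y
    unfolding G_def using that by (intro finite_measure_mono) auto
  have G_seq: "(\<lambda>n. n * G (c n * t)) \<longlonglongrightarrow> K / t" if "0 < t" for t
    using seq[OF tail_functional_norm that] by (simp add: G_def K_def axis_total_norm)
  \<comment> \<open>A zero of \<open>G\<close> would make \<open>n * G (c n)\<close> eventually 0,
    against its limit \<open>K \<ge> 1\<close>.\<close>
  have G_pos: "0 < G x" for x
  proof -
    have "eventually (\<lambda>n. 0 < n * G (c n * 1)) sequentially"
      using G_seq[of 1] \<open>1 \<le> K\<close> by (intro order_tendstoD(1)) auto
    moreover have "eventually (\<lambda>n. x \<le> c n) sequentially"
      using c(2) by (simp add: filterlim_at_top)
    ultimately have "eventually (\<lambda>n. 0 < G x) sequentially"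
    proof eventually_elim
      case (elim n)
      then have "0 < G (c n)" by (simp add: zero_less_mult_iff)
      then show ?case using G_anti[OF elim(2)] by simp
    qed
    then show ?thesis by simp
  qed
  have G_0: "eventually (\<lambda>x. G x < e) at_top" if "0 < e" for e
  proof -
    have "(\<lambda>n. (1 / real n) * (n * G (c n * 1))) \<longlonglongrightarrow> 0 * (K / 1)"
      using G_seq[of 1] by (intro tendsto_mult lim_1_over_n) auto
    then have "eventually (\<lambda>n. (1 / real n) * (n * G (c n * 1)) < e) sequentially"
      using that by (intro order_tendstoD(2)) auto
    moreover have "eventually (\<lambda>n. 0 < n) sequentially" by (rule eventually_gt_at_top)
    ultimately have "eventually (\<lambda>n. G (c n) < e) sequentially"
      by eventually_elim simp
    then obtain n where "G (c n) < e" using eventually_happens' by force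
    then show ?thesis
      using G_anti unfolding eventually_at_top_linorder by (meson le_less_trans)
  qed
  \<comment> \<open>The constant \<open>K\<close> is the limit of \<open>n * G (c n)\<close>.
    Rounding up adds at most \<open>G x\<close> to \<open>N x * G x\<close>, so this product tends
    to \<open>K\<close> as well.\<close>
  define N where "N x = nat \<lceil>K / G x\<rceil>" for x
  have "0 < K / G x" for x using G_pos[of x] \<open>1 \<le> K\<close> by simp
  then have N_eq: "real (N x) = of_int \<lceil>K / G x\<rceil>" for x
    unfolding N_def by (simp add: less_imp_le)
  have N_bounds: "K / G x \<le> N x" "N x \<le> K / G x + 1" for x
    unfolding N_eq by linarith+
  have N_G: "((\<lambda>x. N x * G x) \<longlongrightarrow> K) at_top"
  proof (rule order_tendstoI)
    fix u assume u: "u < K"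
    have "K \<le> N x * G x" for x
      using N_bounds(1)[of x] G_pos[of x] by (simp add: field_simps)
    then show "eventually (\<lambda>x. u < N x * G x) at_top"
      by (intro always_eventually allI less_le_trans[OF u])
  next
    fix u assume "K < u"
    then have "eventually (\<lambda>x. G x < u - K) at_top" by (intro G_0) simp
    moreover have "N x * G x \<le> K + G x" for x
    proof -
      have "N x * G x \<le> (K / G x + 1) * G x"
        using N_bounds(2) G_pos[of x] by (intro mult_right_mono) auto
      then show ?thesis using G_pos[of x] by (simp add: distrib_right)
    qed
    ultimately show "eventually (\<lambda>x. N x * G x < u) at_top"
      by (elim eventually_mono) (smt (verit))
  qed
  have N_top: "filterlim N sequentially at_top"
    unfolding filterlim_at_top
  proof
    fix m :: nat
    have "eventually (\<lambda>x. G x < 1 / (m + 1)) at_top" by (intro G_0) simp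
    then show "eventually (\<lambda>x. m \<le> N x) at_top"
    proof eventually_elim
      case (elim x)
      have "real m \<le> 1 / G x" using elim G_pos[of x] by (simp add: field_simps)
      also have "\<dots> \<le> K / G x" using \<open>1 \<le> K\<close> G_pos[of x] by (simp add: divide_right_mono)
      also have "\<dots> \<le> N x" by (rule N_bounds)
      finally show ?case by simp
    qed
  qed
  have G_N: "((\<lambda>x. N x * G (c (N x) * s)) \<longlongrightarrow> K / s) at_top" if "0 < s" for s
    using filterlim_compose[OF G_seq[OF that] N_top] .
  \<comment> \<open>\<open>c (N x) \<sim> x\<close>: this is what makes the limit along the sequence \<open>c\<close>
    carry over to a continuous parameter, without any regularity of \<open>c\<close>.\<close>
  have c_less: "eventually (\<lambda>x. c (N x) * s < x) at_top" if "0 < s" "s < 1" for s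
  proof -
    have "K < K / s" using that \<open>1 \<le> K\<close> by (simp add: field_simps)
    \<comment> \<open>A value strictly between the two limits eventually separates the two tails; as
      \<open>G\<close> is antitone, the arguments are then ordered the other way.\<close>
    then obtain v where v: "K < v" "v < K / s" using dense by blast
    have "eventually (\<lambda>x. N x * G x < v) at_top" using N_G v(1) by (rule order_tendstoD)
    moreover have "eventually (\<lambda>x. v < N x * G (c (N x) * s)) at_top"
      using G_N[OF that(1)] v(2) by (rule order_tendstoD)
    ultimately show ?thesis
    proof eventually_elim
      case (elim x)
      then have "N x * G x < N x * G (c (N x) * s)" by linarith
      then have "G x < G (c (N x) * s)" by (simp add: mult_less_cancel_left)
      then show ?case using G_anti[of x "c (N x) * s"] by linarith
    qed
  qed
  have c_greater: "eventually (\<lambda>x. x < c (N x) * s) at_top" if "1 < s" for s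
  proof -
    have "K / s < K" using that \<open>1 \<le> K\<close> by (simp add: field_simps)
    then obtain v where v: "K / s < v" "v < K" using dense by blast
    have "eventually (\<lambda>x. v < N x * G x) at_top" using N_G v(2) by (rule order_tendstoD)
    moreover have "eventually (\<lambda>x. N x * G (c (N x) * s) < v) at_top"
      using G_N[of s] v(1) that by (intro order_tendstoD(2)) auto
    ultimately show ?thesis
    proof eventually_elim
      case (elim x)
      then have "N x * G (c (N x) * s) < N x * G x" by linarith
      then have "G (c (N x) * s) < G x" by (simp add: mult_less_cancel_left)
      then show ?case using G_anti[of "c (N x) * s" x] by linarith
    qed
  qed
  show ?thesis
  proof (rule that[of N])
    fix h :: "real ^ 'k \<Rightarrow> real" and t :: real
    assume h: "tail_functional h" and "0 < t"
    have [measurable]: "h \<in> borel_measurable borel"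
      using h by (auto simp: tail_functional_def intro: borel_measurable_continuous_onI)
    define T where "T x = prob {\<omega> \<in> space M. x < h (Z \<omega>)}" for x
    have T_anti: "T y \<le> T x" if "x \<le> y" for x y
      unfolding T_def using that by (intro finite_measure_mono) auto
    have T_N: "((\<lambda>x. N x * T (c (N x) * s)) \<longlongrightarrow> axis_total h / s) at_top" if "0 < s" for s
      unfolding T_def using filterlim_compose[OF seq[OF h that] N_top] .
    have "((\<lambda>x. N x * T (t * x)) \<longlongrightarrow> axis_total h / t) at_top"
    proof (rule tendsto_divide_if_bracketed[OF \<open>0 < t\<close> axis_total_nonneg[OF h]])
      fix s u assume s: "0 < s" "s < t" and "axis_total h / s < u"
      then have "eventually (\<lambda>x. N x * T (c (N x) * s) < u) at_top"
        using T_N order_tendstoD(2) by blast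
      moreover have "eventually (\<lambda>x. c (N x) * (s / t) < x) at_top"
        using s by (intro c_less) auto
      ultimately show "eventually (\<lambda>x. N x * T (t * x) < u) at_top"
      proof eventually_elim
        case (elim x)
        then have "c (N x) * s \<le> t * x" using \<open>0 < t\<close> by (simp add: field_simps)
        then have "N x * T (t * x) \<le> N x * T (c (N x) * s)"
          by (intro mult_left_mono T_anti) auto
        then show ?case using elim by linarith
      qed
    next
      fix s u assume s: "t < s" and "u < axis_total h / s"
      then have "eventually (\<lambda>x. u < N x * T (c (N x) * s)) at_top"
        using T_N[of s] \<open>0 < t\<close> by (intro order_tendstoD(1)) auto
      moreover have "eventually (\<lambda>x. x < c (N x) * (s / t)) at_top"
        using s \<open>0 < t\<close> by (intro c_greater) auto
      ultimately show "eventually (\<lambda>x. u < N x * T (t * x)) at_top"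
      proof eventually_elim
        case (elim x)
        then have "t * x \<le> c (N x) * s" using \<open>0 < t\<close> by (simp add: field_simps)
        then have "N x * T (c (N x) * s) \<le> N x * T (t * x)"
          by (intro mult_left_mono T_anti) auto
        then show ?case using elim by linarith
      qed
    qed
    then show "((\<lambda>x. N x * prob {\<omega> \<in> space M. t * x < h (Z \<omega>)}) \<longlongrightarrow> axis_total h / t) at_top"
      by (simp add: T_def)
  qed
qed

section \<open>From the factors to the observed vector\<close>

lemma X_measurable [measurable]: "X \<in> borel_measurable M"
proof -
  have "(\<lambda>z. A *v z) \<in> borel_measurable borel"
    by (intro borel_measurable_continuous_onI continuous_intros)
  then have "(\<lambda>\<omega>. A *v Z \<omega> + E \<omega>) \<in> borel_measurable M" by measurable
  then show ?thesis by (subst measurable_cong[OF model_eq])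
qed

lemma tail_functional_min:
  "tail_functional (\<lambda>z. min ((A *v z) $ i) ((A *v z) $ j))"
proof -
  have "0 \<le> (A *v z) $ i" if "z \<in> nonneg_orthant" for z i
    using that loadings_nonneg
    by (auto simp: nonneg_orthant_def matrix_vector_mult_def intro!: sum_nonneg)
  then show ?thesis
    unfolding tail_functional_def
    by (auto intro!: continuous_intros simp: matrix_vector_mult_scaleR min_mult_distrib_left)
qed

text \<open>\<open>A\<close> maps the \<open>k\<close>-th unit vector to its \<open>k\<close>-th
  column. This is where \<open>\<odot>\<close> arises from a limit measure concentrated on the
  axes.\<close>

lemma axis_total_min:
  "axis_total (\<lambda>z. min ((A *v z) $ i) ((A *v z) $ j)) = (A \<odot> transpose A) $ i $ j"
  by (simp add: axis_total_def min_prod_transpose_nth matrix_vector_mul_component inner_axis)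

text \<open>The noise changes the threshold \<open>x\<close> to \<open>s * x\<close> at the cost of
  the probability that its norm exceeds a fixed positive multiple of \<open>x\<close>, which is
  negligible at rate \<open>N x\<close>.\<close>

lemma joint_exceedance_limit:
  obtains N :: "real \<Rightarrow> nat" where
    "\<And>i j. ((\<lambda>x. N x * prob {\<omega> \<in> space M. X \<omega> $ i > x \<and> X \<omega> $ j > x})
        \<longlongrightarrow> (A \<odot> transpose A) $ i $ j) at_top"
proof -
  obtain N :: "real \<Rightarrow> nat" where N: "\<And>h t. tail_functional h \<Longrightarrow> 0 < t \<Longrightarrow>
       ((\<lambda>x. N x * prob {\<omega> \<in> space M. t * x < h (Z \<omega>)}) \<longlongrightarrow> axis_total h / t) at_top"
    by (rule tail_functional_limit) blast
  define D where "D x = prob {\<omega> \<in> space M. x < norm (E \<omega>)}" for x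
  have noise: "((\<lambda>x. N x * D (\<delta> * x)) \<longlongrightarrow> 0) at_top" if "0 < \<delta>" for \<delta>
  proof -
    let ?G = "\<lambda>x. prob {\<omega> \<in> space M. x < norm (Z \<omega>)}"
    have lim: "((\<lambda>x. N x * ?G (\<delta> * x)) \<longlongrightarrow> CARD('k) / \<delta>) at_top"
      using N[OF tail_functional_norm that] by (simp add: axis_total_norm)
    have "filterlim (\<lambda>x. \<delta> * x) at_top at_top"
      by (rule filterlim_tendsto_pos_mult_at_top[OF tendsto_const that filterlim_ident])
    \<comment> \<open>The factor tail is inserted: the noise-to-factor ratio tends to 0, while
      \<open>N x\<close> times the factor tail has a finite positive limit.\<close>
    from filterlim_compose[OF E_lighter_tail this]
    have "((\<lambda>x. D (\<delta> * x) / ?G (\<delta> * x) * (N x * ?G (\<delta> * x))) \<longlongrightarrow> 0 * (CARD('k) / \<delta>)) at_top"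
      unfolding D_def by (intro tendsto_mult lim)
    moreover have "eventually (\<lambda>x. 0 < N x * ?G (\<delta> * x)) at_top"
      using that by (intro order_tendstoD(1)[OF lim]) simp
    then have "eventually (\<lambda>x. D (\<delta> * x) / ?G (\<delta> * x) * (N x * ?G (\<delta> * x)) = N x * D (\<delta> * x)) at_top"
      by eventually_elim auto
    ultimately show ?thesis by (auto dest: tendsto_cong[THEN iffD1, rotated])
  qed
  show ?thesis
  proof (rule that[of N])
    fix i j :: 'd
    let ?h = "\<lambda>z. min ((A *v z) $ i) ((A *v z) $ j)"
    let ?H = "(A \<odot> transpose A) $ i $ j"
    define T where "T x = prob {\<omega> \<in> space M. x < ?h (Z \<omega>)}" for x
    define P where "P x = prob {\<omega> \<in> space M. X \<omega> $ i > x \<and> X \<omega> $ j > x}" for x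
    have [measurable]: "?h \<in> borel_measurable borel"
      using tail_functional_min[of i j]
      unfolding tail_functional_def by (auto intro: borel_measurable_continuous_onI)
    have [measurable]: "(\<lambda>v. v $ k) \<in> borel_measurable (borel :: (real ^ 'd) measure)" for k
      by (intro borel_measurable_continuous_onI continuous_intros)
    have T_lim: "((\<lambda>x. N x * T (s * x)) \<longlongrightarrow> ?H / s) at_top" if "0 < s" for s
      using N[OF tail_functional_min that, of i j] by (simp add: T_def axis_total_min)
    have component: "\<bar>X \<omega> $ k - (A *v Z \<omega>) $ k\<bar> \<le> norm (E \<omega>)" if "\<omega> \<in> space M" for \<omega> k
      using model_eq[OF that] component_le_norm_cart[of "E \<omega>" k] by simp
    \<comment> \<open>If the noise norm is at most \<open>(1 - s) * x\<close>, both coordinates of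
      \<open>A *v Z \<omega>\<close> exceed \<open>s * x\<close>. The bound \<open>lower\<close>
      exchanges the roles of \<open>X\<close> and \<open>A *v Z\<close>.\<close>
    have upper: "P x \<le> T (s * x) + D ((1 - s) * x)" for s x
    proof -
      have "P x \<le> prob ({\<omega> \<in> space M. s * x < ?h (Z \<omega>)} \<union>
          {\<omega> \<in> space M. (1 - s) * x < norm (E \<omega>)})"
        unfolding P_def
      proof (rule finite_measure_mono)
        show "{\<omega> \<in> space M. X \<omega> $ i > x \<and> X \<omega> $ j > x} \<subseteq>
          {\<omega> \<in> space M. s * x < ?h (Z \<omega>)} \<union> {\<omega> \<in> space M. (1 - s) * x < norm (E \<omega>)}"
        proof clarsimp
          fix \<omega> assume "\<omega> \<in> space M" "x < X \<omega> $ i" "x < X \<omega> $ j"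
            "\<not> (1 - s) * x < norm (E \<omega>)"
          then show "s * x < (A *v Z \<omega>) $ i \<and> s * x < (A *v Z \<omega>) $ j"
            using component[of \<omega> i] component[of \<omega> j] by (auto simp: algebra_simps)
        qed
      qed measurable
      also have "\<dots> \<le> T (s * x) + D ((1 - s) * x)"
        unfolding T_def D_def by (rule measure_Un_le) measurable
      finally show ?thesis .
    qed
    have lower: "T (s * x) \<le> P x + D ((s - 1) * x)" for s x
    proof -
      have "T (s * x) \<le> prob ({\<omega> \<in> space M. X \<omega> $ i > x \<and> X \<omega> $ j > x} \<union>
          {\<omega> \<in> space M. (s - 1) * x < norm (E \<omega>)})"
        unfolding T_def
      proof (rule finite_measure_mono)
        show "{\<omega> \<in> space M. s * x < ?h (Z \<omega>)} \<subseteq>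
          {\<omega> \<in> space M. X \<omega> $ i > x \<and> X \<omega> $ j > x} \<union> {\<omega> \<in> space M. (s - 1) * x < norm (E \<omega>)}"
        proof clarsimp
          fix \<omega> assume "\<omega> \<in> space M" "s * x < (A *v Z \<omega>) $ i" "s * x < (A *v Z \<omega>) $ j"
            "\<not> (s - 1) * x < norm (E \<omega>)"
          then show "x < X \<omega> $ i \<and> x < X \<omega> $ j"
            using component[of \<omega> i] component[of \<omega> j] by (auto simp: algebra_simps)
        qed
      qed measurable
      also have "\<dots> \<le> P x + D ((s - 1) * x)"
        unfolding P_def D_def by (rule measure_Un_le) measurable
      finally show ?thesis .
    qed
    have "0 \<le> ?H" using axis_total_nonneg[OF tail_functional_min] by (simp add: axis_total_min)
    then have "((\<lambda>x. N x * P x) \<longlongrightarrow> ?H / 1) at_top"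
    proof (intro tendsto_divide_if_bracketed)
      fix s u :: real assume s: "0 < s" "s < 1" and u: "?H / s < u"
      have "((\<lambda>x. N x * T (s * x) + N x * D ((1 - s) * x)) \<longlongrightarrow> ?H / s + 0) at_top"
        using s by (intro tendsto_add T_lim noise) auto
      then have "eventually (\<lambda>x. N x * T (s * x) + N x * D ((1 - s) * x) < u) at_top"
        using u by (intro order_tendstoD(2)) auto
      then show "eventually (\<lambda>x. N x * P x < u) at_top"
      proof eventually_elim
        case (elim x)
        have "N x * P x \<le> N x * (T (s * x) + D ((1 - s) * x))"
          by (intro mult_left_mono upper) auto
        then show ?case using elim by (simp add: distrib_left)
      qed
    next
      fix s u :: real assume s: "1 < s" and u: "u < ?H / s"
      have "((\<lambda>x. N x * T (s * x) - N x * D ((s - 1) * x)) \<longlongrightarrow> ?H / s - 0) at_top"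
        using s by (intro tendsto_diff T_lim noise) auto
      then have "eventually (\<lambda>x. u < N x * T (s * x) - N x * D ((s - 1) * x)) at_top"
        using u by (intro order_tendstoD(1)) auto
      then show "eventually (\<lambda>x. u < N x * P x) at_top"
      proof eventually_elim
        case (elim x)
        have "N x * T (s * x) \<le> N x * (P x + D ((s - 1) * x))"
          by (intro mult_left_mono lower) auto
        then show ?case using elim by (simp add: distrib_left)
      qed
    qed auto
    then show "((\<lambda>x. N x * prob {\<omega> \<in> space M. X \<omega> $ i > x \<and> X \<omega> $ j > x}) \<longlongrightarrow> ?H) at_top"
      by (simp add: P_def)
  qed
qed

text \<open>The denominator is the joint exceedance with \<open>i = j\<close>, whose normalised
  limit is the row sum 1; in the quotient \<open>N\<close> cancels.\<close>

theorem extremal_correlation_matrix_min_prod: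
  assumes "unit_row_sums A"
  shows "extremal_correlation_matrix M X (A \<odot> transpose A)"
  unfolding extremal_correlation_matrix_def
proof (intro allI)
  fix i j :: 'd
  obtain N :: "real \<Rightarrow> nat" where N:
    "\<And>i j. ((\<lambda>x. N x * prob {\<omega> \<in> space M. X \<omega> $ i > x \<and> X \<omega> $ j > x})
        \<longlongrightarrow> (A \<odot> transpose A) $ i $ j) at_top"
    by (rule joint_exceedance_limit) blast
  let ?P = "\<lambda>i j x. prob {\<omega> \<in> space M. X \<omega> $ i > x \<and> X \<omega> $ j > x}"
  have one: "(A \<odot> transpose A) $ j $ j = 1"
    using assms by (simp add: min_prod_transpose_nth unit_row_sums_def)
  have denom: "((\<lambda>x. N x * ?P j j x) \<longlongrightarrow> 1) at_top"
    using N[of j j] by (simp only: one)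
  have "((\<lambda>x. (N x * ?P i j x) / (N x * ?P j j x)) \<longlongrightarrow> (A \<odot> transpose A) $ i $ j / 1) at_top"
    by (intro tendsto_divide N denom) simp
  moreover have "eventually (\<lambda>x. 0 < N x * ?P j j x) at_top"
    using denom by (intro order_tendstoD(1)) auto
  then have "eventually (\<lambda>x. (N x * ?P i j x) / (N x * ?P j j x) =
      ?P i j x / prob {\<omega> \<in> space M. X \<omega> $ j > x}) at_top"
    by eventually_elim auto
  ultimately show "((\<lambda>x. ?P i j x / prob {\<omega> \<in> space M. X \<omega> $ j > x})
      \<longlongrightarrow> (A \<odot> transpose A) $ i $ j) at_top"
    by (auto dest: tendsto_cong[THEN iffD1, rotated])
qed

end

section \<open>Identifiability from the extremal correlations\<close>

theorem theorem3:
  fixes M :: "'w measure"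
    and A :: "real ^ 'k ^ 'd"
    and Z :: "'w \<Rightarrow> real ^ 'k"
    and E X :: "'w \<Rightarrow> real ^ 'd"
  assumes model: "linear_factor_model M A Z E X"
    and rows: "unit_row_sums A"
    and pure: "has_pure_variables A"
  shows "extremal_correlation_matrix M X (A \<odot> transpose A) \<and>
    (\<forall>A' :: real ^ 'l ^ 'd.
       (\<forall>j a. 0 \<le> A' $ j $ a) \<and> unit_row_sums A' \<and> has_pure_variables A' \<and>
       A' \<odot> transpose A' = A \<odot> transpose A
       \<longrightarrow> CARD('l) = CARD('k) \<and>
           (\<exists>\<sigma> :: 'l \<Rightarrow> 'k. bij \<sigma> \<and> A' = A ** permutation_matrix \<sigma> \<and>
              (\<forall>a. soft_cluster A' a = soft_cluster A (\<sigma> a))))"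
proof (intro conjI allI impI)
  interpret linear_factor_model M A Z E X by (rule model)
  show "extremal_correlation_matrix M X (A \<odot> transpose A)"
    using rows by (rule extremal_correlation_matrix_min_prod)
  fix A' :: "real ^ 'l ^ 'd"
  assume "(\<forall>j a. 0 \<le> A' $ j $ a) \<and> unit_row_sums A' \<and> has_pure_variables A' \<and>
       A' \<odot> transpose A' = A \<odot> transpose A"
  then obtain \<sigma> :: "'l \<Rightarrow> 'k" where \<sigma>: "bij \<sigma>" "\<And>j b. A' $ j $ b = A $ j $ \<sigma> b"
    using loadings_identifiable[OF loadings_nonneg rows pure, of A'] by blast
  \<comment> \<open>Right multiplication by \<open>permutation_matrix \<sigma>\<close> puts column
    \<open>\<sigma> b\<close> of \<open>A\<close> at position \<open>b\<close>, and equal columns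
    have equal supports.\<close>
  then show "\<exists>\<sigma> :: 'l \<Rightarrow> 'k. bij \<sigma> \<and> A' = A ** permutation_matrix \<sigma> \<and>
              (\<forall>a. soft_cluster A' a = soft_cluster A (\<sigma> a))"
    by (auto simp: vec_eq_iff matrix_mult_permutation_matrix_nth soft_cluster_def)
  show "CARD('l) = CARD('k)"
    using \<sigma>(1) by (rule bij_betw_same_card)
qed

end
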